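(* Let $X$ be an Archimedean vector lattice and let $(x_n)$ be a disjoint sequence in $X$. Then $x_n\xrightarrow{\rm uo}0$ in $X$.
   Context: All vector lattices are real and Archimedean. A sequence $(x_n)$ is disjoint if $|x_n|\wedge|x_m|=0$ whenever $n\ne m$. A net (in particular, a sequence) $(x_\alpha)_{\alpha\in\Gamma}$ in $X$ converges in order to $x\in X$ ($x_\alpha\xrightarrow{\rm o}x$) if there is a net $(a_\gamma)_{\gamma\in\Lambda}$ in $X$ (possibly over a different index set) with $a_\gamma\downarrow 0$ such that for every $\gamma\in\Lambda$ there is $\alpha_0\in\Gamma$ with $|x_\alpha-x|\le a_\gamma$ for all $\alpha\ge\alpha_0$. It uo-converges to $x$ ($x_\alpha\xrightarrow{\rm uo}x$) if $|x_\alpha-x|\wedge y\xrightarrow{\rm o}0$ for every $y\in X_+$. *)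

theory Defs
  imports Complex_Main "HOL-Library.Lattice_Algebras"
begin

class vector_lattice = ordered_real_vector + lattice_ab_group_add_abs

class archimedean_vector_lattice = vector_lattice +
  assumes archimedean: "(\<And>n::nat. real n *\<^sub>R x \<le> y) \<Longrightarrow> x \<le> 0"

instance real :: vector_lattice ..

instance real :: archimedean_vector_lattice
proof
  fix x y :: real
  assume "\<And>n::nat. real n *\<^sub>R x \<le> y"
  then show "x \<le> 0"
    using reals_Archimedean3[of x] by (metis not_le real_scaleR_def)
qed

definition disjoint_sequence :: "(nat \<Rightarrow> 'a::vector_lattice) \<Rightarrow> bool" where
  "disjoint_sequence x \<longleftrightarrow> (\<forall>n m. n \<noteq> m \<longrightarrow> inf \<bar>x n\<bar> \<bar>x m\<bar> = 0)"

definition directed_set :: "'i set \<Rightarrow> 'i rel \<Rightarrow> bool" where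
  "directed_set I r \<longleftrightarrow> I \<noteq> {} \<and> preorder_on I r \<and>
     (\<forall>i\<in>I. \<forall>j\<in>I. \<exists>k\<in>I. (i, k) \<in> r \<and> (j, k) \<in> r)"

definition net_decreases_to_zero :: "'i set \<Rightarrow> 'i rel \<Rightarrow> ('i \<Rightarrow> 'a::vector_lattice) \<Rightarrow> bool" where
  "net_decreases_to_zero I r a \<longleftrightarrow>
     (\<forall>i\<in>I. \<forall>j\<in>I. (i, j) \<in> r \<longrightarrow> a j \<le> a i) \<and>
     (\<forall>i\<in>I. 0 \<le> a i) \<and> (\<forall>z. (\<forall>i\<in>I. z \<le> a i) \<longrightarrow> z \<le> 0)"

text \<open>HOL cannot quantify over the type of the index set of the dominating net inside a
  definition. Its indices are therefore drawn from the lattice itself; this loses no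
  generality, by \<open>order_convergesI\<close> below.\<close>

definition order_converges ::
    "'i set \<Rightarrow> 'i rel \<Rightarrow> ('i \<Rightarrow> 'a::vector_lattice) \<Rightarrow> 'a \<Rightarrow> bool" where
  "order_converges I r x l \<longleftrightarrow>
     (\<exists>(J :: 'a set) (s :: 'a rel) (a :: 'a \<Rightarrow> 'a).
        directed_set J s \<and> net_decreases_to_zero J s a \<and>
        (\<forall>j\<in>J. \<exists>i0\<in>I. \<forall>i\<in>I. (i0, i) \<in> r \<longrightarrow> \<bar>x i - l\<bar> \<le> a j))"

lemma order_convergesI:
  fixes x :: "'i \<Rightarrow> 'a::vector_lattice" and a :: "'j \<Rightarrow> 'a"
  assumes dir: "directed_set J s" and dec: "net_decreases_to_zero J s a"
    and dom: "\<And>j. j \<in> J \<Longrightarrow> \<exists>i0\<in>I. \<forall>i\<in>I. (i0, i) \<in> r \<longrightarrow> \<bar>x i - l\<bar> \<le> a j"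
  shows "order_converges I r x l"
proof -
  define s' where "s' = {(u, v). u \<in> a ` J \<and> v \<in> a ` J \<and> v \<le> u}"
  have "preorder_on (a ` J) s'"
    unfolding preorder_on_def refl_on_def trans_def s'_def by auto
  moreover have "\<exists>w\<in>a ` J. (u, w) \<in> s' \<and> (v, w) \<in> s'"
    if uv: "u \<in> a ` J" "v \<in> a ` J" for u v
  proof -
    obtain i j where ij: "i \<in> J" "j \<in> J" "u = a i" "v = a j"
      using uv by auto
    obtain k where k: "k \<in> J" "(i, k) \<in> s" "(j, k) \<in> s"
      using dir ij unfolding directed_set_def by blast
    have "a k \<le> a i" "a k \<le> a j"
      using dec ij k unfolding net_decreases_to_zero_def by blast+
    then show ?thesis
      using ij k unfolding s'_def by auto
  qed
  ultimately have 1: "directed_set (a ` J) s'"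
    using dir unfolding directed_set_def by blast
  have 2: "net_decreases_to_zero (a ` J) s' (\<lambda>u. u)"
    using dec unfolding net_decreases_to_zero_def s'_def by auto
  have 3: "\<forall>u\<in>a ` J. \<exists>i0\<in>I. \<forall>i\<in>I. (i0, i) \<in> r \<longrightarrow> \<bar>x i - l\<bar> \<le> u"
    using dom by blast
  show ?thesis
    unfolding order_converges_def using 1 2 3 by blast
qed

definition uo_converges ::
    "'i set \<Rightarrow> 'i rel \<Rightarrow> ('i \<Rightarrow> 'a::vector_lattice) \<Rightarrow> 'a \<Rightarrow> bool" where
  "uo_converges I r x l \<longleftrightarrow> (\<forall>y\<ge>0. order_converges I r (\<lambda>i. inf \<bar>x i - l\<bar> y) 0)"

end

theory Submission
  imports Defs
begin

text \<open>For \<open>y \<ge> 0\<close> put \<open>u n = \<bar>x n\<bar> \<sqinter> y\<close>; the dominating net is the set of all eventual upper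
  bounds of \<open>u\<close>. If \<open>w \<ge> 0\<close> lies below all of them and is eventually disjoint from \<open>u\<close>, then
  \<open>b - w\<close> is an eventual upper bound whenever \<open>b\<close> is, so \<open>k w \<le> y\<close> for all \<open>k\<close> and \<open>w = 0\<close>. For a
  lower bound \<open>z \<ge> 0\<close>, this applies first to \<open>w = z \<sqinter> u k\<close>, which shows that \<open>z\<close> is disjoint from
  every \<open>u k\<close>, and then to \<open>w = z\<close> itself.\<close>

lemma disjoint_add_le:
  fixes u w b :: "'a::vector_lattice"
  assumes "inf u w = 0" "u \<le> b" "w \<le> b"
  shows "u \<le> b - w"
proof -
  have "u + w = sup u w"
    using assms(1) add_eq_inf_sup[of u w] by simp
  also have "\<dots> \<le> b"
    using assms(2,3) by simp
  finally show ?thesis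
    by (simp add: le_diff_eq)
qed

lemma disjoint_lower_bound_eq_zero:
  fixes u :: "nat \<Rightarrow> 'a::archimedean_vector_lattice"
  assumes y: "\<forall>\<^sub>F n in sequentially. u n \<le> y"
    and lower: "\<And>b. \<forall>\<^sub>F n in sequentially. u n \<le> b \<Longrightarrow> w \<le> b"
    and disj: "\<forall>\<^sub>F n in sequentially. inf (u n) w = 0"
    and "0 \<le> w"
  shows "w = 0"
proof -
  have bound: "\<forall>\<^sub>F n in sequentially. u n \<le> y - real k *\<^sub>R w" for k
  proof (induction k)
    case 0
    then show ?case using y by simp
  next
    \<comment> \<open>The induction hypothesis is itself an eventual bound, so \<open>lower\<close>
      puts \<open>w\<close> below it as well; disjointness then allows another \<open>w\<close> to
      be subtracted.\<close>
    case (Suc k)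
    have "\<forall>\<^sub>F n in sequentially. u n \<le> (y - real k *\<^sub>R w) - w"
      using Suc disj by eventually_elim (rule disjoint_add_le[OF _ _ lower[OF Suc]])
    then show ?case
      by (simp add: scaleR_add_left algebra_simps)
  qed
  have "real k *\<^sub>R w \<le> y" for k
  proof -
    have "0 \<le> y - real k *\<^sub>R w"
      using \<open>0 \<le> w\<close> lower[OF bound[of k]] by (rule order_trans)
    then show ?thesis by simp
  qed
  then have "w \<le> 0"
    by (rule archimedean)
  with \<open>0 \<le> w\<close> show ?thesis by simp
qed

lemma lower_bound_of_eventual_bounds_le_zero:
  fixes u :: "nat \<Rightarrow> 'a::archimedean_vector_lattice"
  assumes pos: "\<And>n. 0 \<le> u n"
    and y: "\<And>n. u n \<le> y"
    and disj: "\<And>n m. n \<noteq> m \<Longrightarrow> inf (u n) (u m) = 0"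
    and lower: "\<And>b. \<forall>\<^sub>F n in sequentially. u n \<le> b \<Longrightarrow> z \<le> b"
  shows "z \<le> 0"
proof -
  \<comment> \<open>Passing to the positive part of \<open>z\<close> keeps it below every eventual
    bound, since each such bound dominates some \<open>u n \<ge> 0\<close>.\<close>
  define w where "w = sup z 0"
  have "0 \<le> w"
    unfolding w_def by simp
  have w_lower: "w \<le> b" if b: "\<forall>\<^sub>F n in sequentially. u n \<le> b" for b
  proof -
    obtain n where "u n \<le> b"
      using b by (auto simp: eventually_sequentially)
    then have "0 \<le> b"
      using pos[of n] by (rule order_trans[rotated])
    then show ?thesis
      using lower[OF b] by (simp add: w_def)
  qed
  have y': "\<forall>\<^sub>F n in sequentially. u n \<le> y"
    using y by simp
  have "inf (u k) w = 0" for k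
  proof (rule disjoint_lower_bound_eq_zero[OF y'])
    show "inf (u k) w \<le> b" if "\<forall>\<^sub>F n in sequentially. u n \<le> b" for b
      using w_lower[OF that] by (rule le_infI2)
    \<comment> \<open>For \<open>n > k\<close> the meet already vanishes because
      \<open>inf (u k) w\<close> lies below \<open>u k\<close>.\<close>
    show "\<forall>\<^sub>F n in sequentially. inf (u n) (inf (u k) w) = 0"
      using eventually_gt_at_top[of k]
    proof eventually_elim
      case (elim n)
      then have "inf (u n) (u k) = 0"
        by (intro disj) simp
      then show ?case
        using \<open>0 \<le> w\<close> by (simp add: inf_assoc[symmetric] inf_absorb1)
    qed
    show "0 \<le> inf (u k) w"
      using pos \<open>0 \<le> w\<close> by simp
  qed
  then have "w = 0"
    using disjoint_lower_bound_eq_zero[OF y' w_lower] \<open>0 \<le> w\<close> by simp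
  then show ?thesis
    unfolding w_def by (metis sup.cobounded1)
qed

lemma order_converges_zero_if_disjoint_bounded:
  fixes u :: "nat \<Rightarrow> 'a::archimedean_vector_lattice"
  assumes pos: "\<And>n. 0 \<le> u n"
    and y: "\<And>n. u n \<le> y"
    and disj: "\<And>n m. n \<noteq> m \<Longrightarrow> inf (u n) (u m) = 0"
  shows "order_converges UNIV {(m, n). m \<le> n} u 0"
proof -
  \<comment> \<open>The bounds index themselves under the reversed order: \<open>y\<close> makes
    \<open>J\<close> nonempty, and closure under \<open>inf\<close> makes it directed.\<close>
  define J where "J = {b. \<forall>\<^sub>F n in sequentially. u n \<le> b}"
  define s where "s = {(b, c). b \<in> J \<and> c \<in> J \<and> c \<le> b}"
  have "preorder_on J s"
    unfolding preorder_on_def refl_on_def trans_def s_def by auto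
  moreover have "y \<in> J"
    using y by (simp add: J_def)
  moreover have "inf b c \<in> J" if "b \<in> J" "c \<in> J" for b c
    using that by (simp add: J_def eventually_conj_iff)
  ultimately have dir: "directed_set J s"
    unfolding directed_set_def s_def by (fastforce intro: bexI[of _ "inf _ _"])
  have "0 \<le> b" if b: "b \<in> J" for b
  proof -
    obtain n where "u n \<le> b"
      using b by (auto simp: J_def eventually_sequentially)
    with pos[of n] show ?thesis
      by (rule order_trans)
  qed
  moreover have "z \<le> 0" if "\<forall>b\<in>J. z \<le> b" for z
    using lower_bound_of_eventual_bounds_le_zero[OF pos y disj] that
    by (simp add: J_def)
  ultimately have dec: "net_decreases_to_zero J s (\<lambda>b. b)"
    unfolding net_decreases_to_zero_def s_def by auto
  show ?thesis
    by (rule order_convergesI[OF dir dec])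
      (use pos in \<open>auto simp: J_def eventually_sequentially\<close>)
qed

theorem corollary3p6:
  fixes x :: "nat \<Rightarrow> 'a::archimedean_vector_lattice"
  assumes "disjoint_sequence x"
  shows "uo_converges UNIV {(m, n). m \<le> n} x 0"
  unfolding uo_converges_def
proof (intro allI impI)
  fix y :: 'a
  assume "0 \<le> y"
  \<comment> \<open>Truncation by \<open>y \<ge> 0\<close> preserves disjointness and makes the
    sequence order bounded.\<close>
  have "inf (inf \<bar>x n\<bar> y) (inf \<bar>x m\<bar> y) = 0" if "n \<noteq> m" for n m
  proof -
    have "inf (inf \<bar>x n\<bar> y) (inf \<bar>x m\<bar> y) = inf (inf \<bar>x n\<bar> \<bar>x m\<bar>) y"
      by (simp add: inf.assoc inf.commute inf.left_commute)
    also have "\<dots> = 0"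
      using assms that \<open>0 \<le> y\<close> by (simp add: disjoint_sequence_def inf_absorb1)
    finally show ?thesis .
  qed
  then show "order_converges UNIV {(m, n). m \<le> n} (\<lambda>i. inf \<bar>x i - 0\<bar> y) 0"
    using \<open>0 \<le> y\<close> by (intro order_converges_zero_if_disjoint_bounded[where y = y]) simp_all
qed

end
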